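(* For a positive integer $m$ let $$T_m=\operatorname{conv}\{(0,0,0),(1,0,0),(0,1,0),(1,1,m)\}\subset\mathbb R^3,\qquad \widetilde T_m=T_m+[\mathbf 0,\mathbf e_3],$$ where $\mathbf e_3=(0,0,1)$, $[\mathbf 0,\mathbf e_3]$ is the segment joining $\mathbf 0$ and $\mathbf e_3$, and the sum is a Minkowski sum. For every positive integer $m$, $\widetilde T_m$ is a non-centrally symmetric minimal covering body for $\mathbb Z^3$. Moreover, the bodies $\widetilde T_m$ (for $m=1,2,3,\ldots$, each taken with the lattice $\mathbb Z^3$) have pairwise distinct arithmetic contact types.
   Context: A convex body in $\mathbb R^n$ is a compact convex set with nonempty interior. Let $\Lambda\subset\mathbb R^n$ be a full-rank lattice. A convex body $K$ is a minimal covering body with respect to (or for) $\Lambda$ if $K+\Lambda=\mathbb R^n$ and no proper convex subbody $K'\subsetneq K$ (i.e. no convex body properly contained in $K$) satisfies $K'+\Lambda=\mathbb R^n$; then $(K,\Lambda)$ is called a minimal covering pair. (Every minimal covering body is a polytope.) Contact data. For a minimal covering pair $(K,\Lambda)$, let $V(K)$ be the vertex set of $K$ and $\mathcal F(K)$ its face lattice, including $\varnothing$ and $K$. For $\mathbf p\in K$, the face carrier $F_K(\mathbf p)$ is the unique face of $K$ whose relative interior contains $\mathbf p$. For $\mathbf v\in V(K)$ put $$\mathcal Z_K(\mathbf v)=(K-\mathbf v)\cap\Lambda=\{\mathbf z\in\Lambda:\mathbf v+\mathbf z\in K\},\qquad \iota_{\mathbf v}:\mathcal Z_K(\mathbf v)\to\mathcal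 F(K),\quad \iota_{\mathbf v}(\mathbf z)=F_K(\mathbf v+\mathbf z).$$ Arithmetic contact type. The arithmetic contact profile of $(K,\Lambda)$ consists of $\mathcal F(K)$, $\Lambda$, and the data $\{(\mathcal Z_K(\mathbf v),\mathbf 0,\iota_{\mathbf v}):\mathbf v\in V(K)\}$. For another minimal covering pair $(K',\Lambda')$ (with carrier maps $\iota'$), a profile isomorphism consists of a lattice (group) isomorphism $U:\Lambda\to\Lambda'$, a bijection $\phi:V(K)\to V(K')$, and a face-lattice isomorphism $\Phi:\mathcal F(K)\to\mathcal F(K')$ such that (i) $\Phi(\{\mathbf v\})=\{\phi(\mathbf v)\}$ for all $\mathbf v\in V(K)$; (ii) $U\mathcal Z_K(\mathbf v)=\mathcal Z_{K'}(\phi(\mathbf v))$ for all $\mathbf v\in V(K)$; (iii) $\Phi(\iota_{\mathbf v}(\mathbf z))=\iota'_{\phi(\mathbf v)}(U\mathbf z)$ for all $\mathbf v\in V(K)$ and $\mathbf z\in\mathcal Z_K(\mathbf v)$. The same $U$ is used at every vertex. Two minimal covering pairs have the same arithmetic contact type if a profile isomorphism between them exists, and distinct arithmetic contact types otherwise. *)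

theory Defs
  imports "HOL-Analysis.Analysis" "HOL-Library.Set_Algebras"
begin

text \<open>
  Throughout, \<open>A + B\<close> for sets is the Minkowski sum of Set_Algebras.
\<close>

definition convex_body :: "'a::euclidean_space set \<Rightarrow> bool" where
  "convex_body K \<longleftrightarrow> compact K \<and> convex K \<and> interior K \<noteq> {}"

definition full_rank_lattice :: "'a::euclidean_space set \<Rightarrow> bool" where
  "full_rank_lattice \<Lambda> \<longleftrightarrow>
     (\<exists>B. independent B \<and> span B = UNIV \<and>
          \<Lambda> = {\<Sum>b\<in>B. real_of_int (c b) *\<^sub>R b | c. True})"

definition minimal_covering_body :: "'a::euclidean_space set \<Rightarrow> 'a set \<Rightarrow> bool" where
  "minimal_covering_body \<Lambda> K \<longleftrightarrow>
     convex_body K \<and> K + \<Lambda> = UNIV \<and>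
     (\<forall>K'. convex_body K' \<and> K' \<subset> K \<longrightarrow> K' + \<Lambda> \<noteq> UNIV)"

definition minimal_covering_pair :: "'a::euclidean_space set \<Rightarrow> 'a set \<Rightarrow> bool" where
  "minimal_covering_pair K \<Lambda> \<longleftrightarrow> full_rank_lattice \<Lambda> \<and> minimal_covering_body \<Lambda> K"

definition centrally_symmetric :: "'a::real_vector set \<Rightarrow> bool" where
  "centrally_symmetric K \<longleftrightarrow> (\<exists>c. (\<lambda>x. 2 *\<^sub>R c - x) ` K = K)"

definition vertices :: "'a::euclidean_space set \<Rightarrow> 'a set" where
  "vertices K = {v. v extreme_point_of K}"

definition faces :: "'a::euclidean_space set \<Rightarrow> 'a set set" where
  "faces K = {F. F face_of K}"

text \<open>Only meaningful for \<open>p \<in> K\<close>, where the face is unique.\<close>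

definition face_carrier :: "'a::euclidean_space set \<Rightarrow> 'a \<Rightarrow> 'a set" where
  "face_carrier K p = (THE F. F face_of K \<and> p \<in> rel_interior F)"

definition contact_set :: "'a::euclidean_space set \<Rightarrow> 'a set \<Rightarrow> 'a \<Rightarrow> 'a set" where
  "contact_set K \<Lambda> v = {z \<in> \<Lambda>. v + z \<in> K}"

definition carrier_map :: "'a::euclidean_space set \<Rightarrow> 'a \<Rightarrow> 'a \<Rightarrow> 'a set" where
  "carrier_map K v z = face_carrier K (v + z)"

definition lattice_isomorphism ::
    "'a::euclidean_space set \<Rightarrow> 'b::euclidean_space set \<Rightarrow> ('a \<Rightarrow> 'b) \<Rightarrow> bool" where
  "lattice_isomorphism \<Lambda> \<Lambda>' U \<longleftrightarrow>
     bij_betw U \<Lambda> \<Lambda>' \<and> (\<forall>x\<in>\<Lambda>. \<forall>y\<in>\<Lambda>. U (x + y) = U x + U y)"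

definition face_lattice_isomorphism ::
    "'a::euclidean_space set \<Rightarrow> 'b::euclidean_space set \<Rightarrow> ('a set \<Rightarrow> 'b set) \<Rightarrow> bool" where
  "face_lattice_isomorphism K K' \<Phi> \<longleftrightarrow>
     bij_betw \<Phi> (faces K) (faces K') \<and>
     (\<forall>F\<in>faces K. \<forall>G\<in>faces K. \<Phi> F \<subseteq> \<Phi> G \<longleftrightarrow> F \<subseteq> G)"

definition profile_isomorphism ::
    "'a::euclidean_space set \<Rightarrow> 'a set \<Rightarrow> 'b::euclidean_space set \<Rightarrow> 'b set \<Rightarrow>
     ('a \<Rightarrow> 'b) \<Rightarrow> ('a \<Rightarrow> 'b) \<Rightarrow> ('a set \<Rightarrow> 'b set) \<Rightarrow> bool" where
  "profile_isomorphism K \<Lambda> K' \<Lambda>' U \<phi> \<Phi> \<longleftrightarrow>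
     lattice_isomorphism \<Lambda> \<Lambda>' U \<and>
     bij_betw \<phi> (vertices K) (vertices K') \<and>
     face_lattice_isomorphism K K' \<Phi> \<and>
     (\<forall>v\<in>vertices K. \<Phi> {v} = {\<phi> v}) \<and>
     (\<forall>v\<in>vertices K. U ` contact_set K \<Lambda> v = contact_set K' \<Lambda>' (\<phi> v)) \<and>
     (\<forall>v\<in>vertices K. \<forall>z\<in>contact_set K \<Lambda> v.
        \<Phi> (carrier_map K v z) = carrier_map K' (\<phi> v) (U z))"

text \<open>Intended for minimal covering pairs \<open>(K, \<Lambda>)\<close> and \<open>(K', \<Lambda>')\<close>.\<close>

definition same_arithmetic_contact_type ::
    "'a::euclidean_space set \<Rightarrow> 'a set \<Rightarrow> 'b::euclidean_space set \<Rightarrow> 'b set \<Rightarrow> bool" where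
  "same_arithmetic_contact_type K \<Lambda> K' \<Lambda>' \<longleftrightarrow>
     (\<exists>U \<phi> \<Phi>. profile_isomorphism K \<Lambda> K' \<Lambda>' U \<phi> \<Phi>)"

definition integer_lattice :: "(real ^ 'n) set" where
  "integer_lattice = {x. \<forall>i. x $ i \<in> \<int>}"

definition T :: "nat \<Rightarrow> (real ^ 3) set" where
  "T m = convex hull {vector [0, 0, 0], vector [1, 0, 0], vector [0, 1, 0], vector [1, 1, real m]}"

definition T_tilde :: "nat \<Rightarrow> (real ^ 3) set" where
  "T_tilde m = T m + closed_segment 0 (vector [0, 0, 1])"

end

theory Submission
  imports Defs
begin

text \<open>
  The vertical fibre of \<open>T_tilde m\<close> over a point \<open>(x, y)\<close> of the unit square is an interval that
  contains \<open>[m x y, m x y + 1]\<close>, so it has length at least 1, and over the four corners of the square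
  its length is exactly 1.  Everything about a single body rests on these two facts.

  \<^item> Covering: every point can be moved over the unit square by a lattice vector, and then
    vertically into the fibre.

  \<^item> Minimality: let \<open>K'\<close> be a convex body inside \<open>T_tilde m\<close> that still covers.  Over an interior point
    of the square only vertical lattice vectors help, so the fibre of \<open>K'\<close> there must have length at
    least 1.  By compactness this persists over the corners, where the fibre of \<open>T_tilde m\<close> has no more
    than that.  Hence \<open>K'\<close> contains both copies of each vertex of \<open>T m\<close> and, by convexity, all of
    \<open>T_tilde m\<close> (\<open>T_tilde_no_smaller_cover\<close>).

  \<^item> Asymmetry: a point reflection would map the square to itself and each corner to the opposite one; the fibres over \<open>(1,0)\<close> and \<open>(0,1)\<close> put the centre at height \<open>1/2\<close>, those over
    \<open>(0,0)\<close> and \<open>(1,1)\<close> at height \<open>(m+1)/2\<close>.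

  The contact types are told apart by an arithmetic invariant of a single contact set \<open>Z\<close>: the
  largest \<open>k\<close> for which some \<open>p + q - r - s\<close> with \<open>p, q, r, s \<in> Z\<close> is \<open>k\<close> times a nonzero lattice
  vector.  It is preserved by every lattice isomorphism carrying one contact set onto another.  At
  the vertex \<open>0\<close> the value \<open>m + 2\<close> is attained, because
  \<open>(0,0,1) + (1,1,m+1) - (1,0,0) - (0,1,0) = (m+2) (0,0,1)\<close>.  At no vertex is it exceeded: if \<open>k > 2\<close>
  then the horizontal coordinates of the lattice vector vanish, since those of \<open>p + q - r - s\<close> lie
  in \<open>[-2, 2]\<close>, and the height of a vertical \<open>p + q - r - s\<close> is at most twice the length \<open>m/2 + 1\<close> of
  the longest vertical fibre (\<open>multiple_in_double_difference_le\<close>).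
\<close>

section \<open>The integer lattice\<close>

lemma full_rank_integer_lattice: "full_rank_lattice (integer_lattice :: (real ^ 'n) set)"
  unfolding full_rank_lattice_def
proof (intro exI conjI)
  show "independent (Basis :: (real ^ 'n) set)"
    by (rule independent_Basis)
  show "span (Basis :: (real ^ 'n) set) = UNIV"
    by (rule span_Basis)
  show "(integer_lattice :: (real ^ 'n) set) =
      {\<Sum>b\<in>Basis. real_of_int (c b) *\<^sub>R b | c. True}" (is "_ = ?L")
  proof (intro set_eqI iffI)
    fix x :: "real ^ 'n"
    assume x: "x \<in> integer_lattice"
    have "real_of_int \<lfloor>x \<bullet> b\<rfloor> = x \<bullet> b" if "b \<in> Basis" for b
    proof -
      have "x \<bullet> b \<in> \<int>"
        using that x by (auto simp: Basis_vec_def integer_lattice_def inner_axis)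
      then show ?thesis
        by (metis Ints_cases floor_of_int)
    qed
    then have "(\<Sum>b\<in>Basis. real_of_int \<lfloor>x \<bullet> b\<rfloor> *\<^sub>R b) = (\<Sum>b\<in>Basis. (x \<bullet> b) *\<^sub>R b)"
      by (intro sum.cong) auto
    then have "x = (\<Sum>b\<in>Basis. real_of_int \<lfloor>x \<bullet> b\<rfloor> *\<^sub>R b)"
      by (simp only: euclidean_representation)
    then show "x \<in> ?L"
      by (intro CollectI exI[of _ "\<lambda>b. \<lfloor>x \<bullet> b\<rfloor>"] conjI TrueI)
  next
    fix x :: "real ^ 'n"
    assume "x \<in> ?L"
    then obtain c where c: "x = (\<Sum>b\<in>Basis. real_of_int (c b) *\<^sub>R b)"
      by blast
    have "x $ i \<in> \<int>" for i
    proof -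
      have "x $ i = x \<bullet> axis i 1"
        by (simp add: inner_axis)
      also have "\<dots> = real_of_int (c (axis i 1))"
        unfolding c by (subst inner_sum_left_Basis) (auto simp: Basis_vec_def)
      finally show ?thesis
        by simp
    qed
    then show "x \<in> integer_lattice"
      by (simp add: integer_lattice_def)
  qed
qed

lemma integer_lattice_3:
  "(p :: real ^ 3) \<in> integer_lattice \<longleftrightarrow> p $ 1 \<in> \<int> \<and> p $ 2 \<in> \<int> \<and> p $ 3 \<in> \<int>"
  by (simp add: integer_lattice_def forall_3)

lemma integer_lattice_add:
  "x \<in> integer_lattice \<Longrightarrow> y \<in> integer_lattice \<Longrightarrow> x + y \<in> integer_lattice"
  by (simp add: integer_lattice_def)

lemma integer_lattice_scale_nat:
  "x \<in> integer_lattice \<Longrightarrow> real k *\<^sub>R x \<in> integer_lattice"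
  by (simp add: integer_lattice_def)

lemma zero_in_integer_lattice: "0 \<in> integer_lattice"
  by (simp add: integer_lattice_def)


section \<open>Lattice isomorphisms\<close>

lemma lattice_isomorphism_inv_into:
  assumes U: "lattice_isomorphism \<Lambda> \<Lambda>' U"
    and closed: "\<And>x y. x \<in> \<Lambda> \<Longrightarrow> y \<in> \<Lambda> \<Longrightarrow> x + y \<in> \<Lambda>"
  shows "lattice_isomorphism \<Lambda>' \<Lambda> (inv_into \<Lambda> U)"
proof -
  have bij: "bij_betw U \<Lambda> \<Lambda>'" and add: "\<And>x y. x \<in> \<Lambda> \<Longrightarrow> y \<in> \<Lambda> \<Longrightarrow> U (x + y) = U x + U y"
    using U by (auto simp: lattice_isomorphism_def)
  have "inv_into \<Lambda> U (x + y) = inv_into \<Lambda> U x + inv_into \<Lambda> U y"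
    if "x \<in> \<Lambda>'" "y \<in> \<Lambda>'" for x y
  proof (rule inv_into_f_eq)
    have mem: "inv_into \<Lambda> U x \<in> \<Lambda>" "inv_into \<Lambda> U y \<in> \<Lambda>"
      using bij that by (auto simp: bij_betw_def inv_into_into)
    show "inj_on U \<Lambda>"
      using bij by (simp add: bij_betw_def)
    show "inv_into \<Lambda> U x + inv_into \<Lambda> U y \<in> \<Lambda>"
      using mem closed by blast
    show "U (inv_into \<Lambda> U x + inv_into \<Lambda> U y) = x + y"
      using bij that mem by (simp add: add bij_betw_inv_into_right)
  qed
  then show ?thesis
    using bij by (simp add: lattice_isomorphism_def bij_betw_inv_into)
qed

context
  fixes U :: "real ^ 'n \<Rightarrow> 'b::euclidean_space" and \<Lambda>'
  assumes U: "lattice_isomorphism integer_lattice \<Lambda>' U"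
begin

lemma lattice_isomorphism_add:
  "x \<in> integer_lattice \<Longrightarrow> y \<in> integer_lattice \<Longrightarrow> U (x + y) = U x + U y"
  using U by (simp add: lattice_isomorphism_def)

lemma lattice_isomorphism_zero: "U 0 = 0"
  using lattice_isomorphism_add[of 0 0] by (simp add: zero_in_integer_lattice)

lemma lattice_isomorphism_scale_nat:
  assumes x: "x \<in> integer_lattice"
  shows "U (real k *\<^sub>R x) = real k *\<^sub>R U x"
proof (induction k)
  case 0
  then show ?case
    by (simp add: lattice_isomorphism_zero)
next
  case (Suc k)
  have "U (real (Suc k) *\<^sub>R x) = U (real k *\<^sub>R x + x)"
    by (simp add: algebra_simps)
  also have "\<dots> = real k *\<^sub>R U x + U x"
    using x Suc by (simp add: lattice_isomorphism_add integer_lattice_scale_nat)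
  finally show ?case
    by (simp add: algebra_simps)
qed

lemma lattice_isomorphism_nonzero:
  assumes "x \<in> integer_lattice" "x \<noteq> 0"
  shows "U x \<noteq> 0"
proof -
  have "inj_on U integer_lattice"
    using U by (simp add: lattice_isomorphism_def bij_betw_def)
  then have "U x \<noteq> U 0"
    using assms zero_in_integer_lattice by (auto dest: inj_onD)
  then show ?thesis
    by (simp add: lattice_isomorphism_zero)
qed

end


section \<open>Inequalities and fibres of the bodies\<close>

lemma vec3_eq_iff: "(p :: real ^ 3) = q \<longleftrightarrow> p $ 1 = q $ 1 \<and> p $ 2 = q $ 2 \<and> p $ 3 = q $ 3"
  by (simp add: vec_eq_iff forall_3)

lemma T_tilde_iff:
  "p \<in> T_tilde m \<longleftrightarrow> (\<exists>q\<in>T m. \<exists>t. 0 \<le> t \<and> t \<le> 1 \<and> p = q + vector [0, 0, t])"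
proof -
  have "closed_segment 0 (vector [0, 0, 1] :: real ^ 3) = {vector [0, 0, t] | t. 0 \<le> t \<and> t \<le> 1}"
    by (auto simp: closed_segment_def vec3_eq_iff intro!: exI)
  then show ?thesis
    unfolding T_tilde_def set_plus_def by auto
qed

lemma T_le:
  assumes "p \<in> T m"
    and "0 \<le> c" "\<alpha> \<le> c" "\<beta> \<le> c" "\<alpha> + \<beta> + \<gamma> * real m \<le> c"
  shows "\<alpha> * p $ 1 + \<beta> * p $ 2 + \<gamma> * p $ 3 \<le> c"
proof -
  let ?H = "{p. vector [\<alpha>, \<beta>, \<gamma>] \<bullet> (p :: real ^ 3) \<le> c}"
  have "T m \<subseteq> ?H"
    unfolding T_def
  proof (rule hull_minimal)
    show "convex ?H"
      by (rule convex_halfspace_le)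
  qed (use assms in \<open>auto simp: inner_vec_def sum_3\<close>)
  then show ?thesis
    using assms(1) by (auto simp: inner_vec_def sum_3)
qed

text \<open>
  The terms \<open>max 0 \<gamma>\<close> account for the larger value of the functional at the two ends of the vertical
  segment above each vertex of the tetrahedron.
\<close>

lemma T_tilde_le:
  assumes p: "p \<in> T_tilde m"
    and "max 0 \<gamma> \<le> c" "\<alpha> + max 0 \<gamma> \<le> c" "\<beta> + max 0 \<gamma> \<le> c" "\<alpha> + \<beta> + \<gamma> * real m + max 0 \<gamma> \<le> c"
  shows "\<alpha> * p $ 1 + \<beta> * p $ 2 + \<gamma> * p $ 3 \<le> c"
proof -
  from p obtain q t where q: "q \<in> T m" and t: "0 \<le> t" "t \<le> 1" and pq: "p = q + vector [0, 0, t]"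
    unfolding T_tilde_iff by blast
  have "\<gamma> * t \<le> max 0 \<gamma>"
    using t by (cases "\<gamma> \<ge> 0") (auto simp: mult_left_le mult_nonpos_nonneg)
  moreover have "\<alpha> * q $ 1 + \<beta> * q $ 2 + \<gamma> * q $ 3 \<le> c - max 0 \<gamma>"
    by (rule T_le[OF q]) (use assms in auto)
  ultimately show ?thesis
    by (simp add: pq algebra_simps)
qed

lemma T_tilde_bounds:
  assumes p: "p \<in> T_tilde m"
  shows "0 \<le> p $ 1" "p $ 1 \<le> 1" "0 \<le> p $ 2" "p $ 2 \<le> 1"
    and "0 \<le> p $ 3" "real m * (p $ 1 + p $ 2 - 1) \<le> p $ 3"
    and "p $ 3 \<le> real m * p $ 1 + 1" "p $ 3 \<le> real m * p $ 2 + 1"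
proof -
  note le = T_tilde_le[OF p]
  show "0 \<le> p $ 1" using le[where \<alpha> = "-1" and \<beta> = 0 and \<gamma> = 0 and c = 0] by simp
  show "p $ 1 \<le> 1" using le[where \<alpha> = 1 and \<beta> = 0 and \<gamma> = 0 and c = 1] by simp
  show "0 \<le> p $ 2" using le[where \<alpha> = 0 and \<beta> = "-1" and \<gamma> = 0 and c = 0] by simp
  show "p $ 2 \<le> 1" using le[where \<alpha> = 0 and \<beta> = 1 and \<gamma> = 0 and c = 1] by simp
  show "0 \<le> p $ 3" using le[where \<alpha> = 0 and \<beta> = 0 and \<gamma> = "-1" and c = 0] by simp
  show "real m * (p $ 1 + p $ 2 - 1) \<le> p $ 3"
    using le[where \<alpha> = "real m" and \<beta> = "real m" and \<gamma> = "-1" and c = "real m"]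
    by (simp add: algebra_simps)
  show "p $ 3 \<le> real m * p $ 1 + 1"
    using le[where \<alpha> = "- real m" and \<beta> = 0 and \<gamma> = 1 and c = 1] by simp
  show "p $ 3 \<le> real m * p $ 2 + 1"
    using le[where \<alpha> = 0 and \<beta> = "- real m" and \<gamma> = 1 and c = 1] by simp
qed

text \<open>
  The bilinear interpolation of the four vertices of the tetrahedron is a convex combination of them
  and gives one point over each point of the unit square.
\<close>

lemma T_saddle_point:
  assumes "0 \<le> x" "x \<le> 1" "0 \<le> y" "y \<le> 1"
  shows "vector [x, y, real m * x * y] \<in> T m"
proof -
  let ?a = "vector [0, 0, 0] :: real ^ 3" and ?b = "vector [1, 0, 0] :: real ^ 3"
    and ?c = "vector [0, 1, 0] :: real ^ 3" and ?d = "vector [1, 1, real m] :: real ^ 3"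
  have cvx: "convex (T m)"
    unfolding T_def by (rule convex_convex_hull)
  have "?a \<in> T m" "?b \<in> T m" "?c \<in> T m" "?d \<in> T m"
    unfolding T_def by (auto intro: hull_inc)
  then have "(1 - y) *\<^sub>R ((1 - x) *\<^sub>R ?a + x *\<^sub>R ?b) + y *\<^sub>R ((1 - x) *\<^sub>R ?c + x *\<^sub>R ?d) \<in> T m"
    using assms cvx by (intro convexD[OF cvx]) auto
  also have "(1 - y) *\<^sub>R ((1 - x) *\<^sub>R ?a + x *\<^sub>R ?b) + y *\<^sub>R ((1 - x) *\<^sub>R ?c + x *\<^sub>R ?d) =
      vector [x, y, real m * x * y]"
    by (simp add: vec3_eq_iff algebra_simps)
  finally show ?thesis .
qed

lemma T_tilde_fibre:
  assumes "0 \<le> x" "x \<le> 1" "0 \<le> y" "y \<le> 1" "real m * x * y \<le> z" "z \<le> real m * x * y + 1"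
  shows "vector [x, y, z] \<in> T_tilde m"
  unfolding T_tilde_iff
proof (intro bexI exI conjI)
  show "vector [x, y, real m * x * y] \<in> T m"
    using assms by (intro T_saddle_point)
  show "0 \<le> z - real m * x * y" "z - real m * x * y \<le> 1"
    using assms by auto
  show "vector [x, y, z] =
      vector [x, y, real m * x * y] + (vector [0, 0, z - real m * x * y] :: real ^ 3)"
    by (simp add: vec3_eq_iff)
qed

lemma T_tilde_vertices:
  "0 \<in> T_tilde m" "vector [0, 0, 1] \<in> T_tilde m" "vector [1, 0, 0] \<in> T_tilde m"
  "vector [0, 1, 0] \<in> T_tilde m" "vector [1, 1, real m] \<in> T_tilde m"
  "vector [1, 1, real m + 1] \<in> T_tilde m"
proof -
  have "(0 :: real ^ 3) = vector [0, 0, 0]"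
    by (simp add: vec3_eq_iff)
  then show "0 \<in> T_tilde m"
    using T_tilde_fibre[of 0 0 m 0] by simp
qed (use T_tilde_fibre[of _ _ m] in auto)

lemma zero_in_vertices_T_tilde: "0 \<in> vertices (T_tilde m)"
  unfolding vertices_def mem_Collect_eq extreme_point_of_def
proof (intro conjI ballI notI)
  show "0 \<in> T_tilde m"
    by (rule T_tilde_vertices)
next
  fix p q
  assume p: "p \<in> T_tilde m" and q: "q \<in> T_tilde m" and "0 \<in> open_segment p q"
  then obtain u where u: "p \<noteq> q" "0 < u" "u < 1" and eq: "0 = (1 - u) *\<^sub>R p + u *\<^sub>R q"
    by (auto simp: in_segment)
  \<comment> \<open>All coordinates are nonnegative on the body, so a vanishing mixture forces them all to vanish.\<close>
  have "p $ i = q $ i" if "0 \<le> p $ i" "0 \<le> q $ i" for i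
  proof -
    have "(1 - u) * p $ i + u * q $ i = 0"
      using arg_cong[OF eq, of "\<lambda>v. v $ i"] by simp
    moreover have "0 \<le> (1 - u) * p $ i" "0 \<le> u * q $ i"
      using u that by auto
    ultimately have "(1 - u) * p $ i = 0" "u * q $ i = 0"
      by linarith+
    then show ?thesis
      using u by simp
  qed
  then have "p = q"
    using T_tilde_bounds(1,3,5)[OF p] T_tilde_bounds(1,3,5)[OF q] by (simp add: vec3_eq_iff)
  with u show False
    by simp
qed


section \<open>Minimal covering\<close>

lemma compact_T_tilde: "compact (T_tilde m)"
proof -
  let ?e = "vector [0, 0, 1] :: real ^ 3"
  have "compact {x + y | x y. x \<in> T m \<and> y \<in> closed_segment 0 ?e}"
    unfolding T_def by (intro compact_sums finite_imp_compact_convex_hull compact_segment) simp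
  also have "{x + y | x y. x \<in> T m \<and> y \<in> closed_segment 0 ?e} = T_tilde m"
    unfolding T_tilde_def set_plus_def by blast
  finally show ?thesis .
qed

lemma convex_T_tilde: "convex (T_tilde m)"
  unfolding T_tilde_def T_def by (intro convex_set_plus convex_convex_hull convex_closed_segment)

lemma convex_body_T_tilde: "convex_body (T_tilde m)"
proof -
  let ?O = "{p :: real ^ 3. 0 < p $ 1} \<inter> {p. p $ 1 < 1} \<inter> {p. 0 < p $ 2} \<inter> {p. p $ 2 < 1}
    \<inter> {p. real m * p $ 1 * p $ 2 < p $ 3} \<inter> {p. p $ 3 < real m * p $ 1 * p $ 2 + 1}"
  have "open ?O"
    by (intro open_Int open_Collect_less continuous_intros)
  moreover have "?O \<subseteq> T_tilde m"
  proof
    fix p :: "real ^ 3"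
    assume "p \<in> ?O"
    then have "vector [p $ 1, p $ 2, p $ 3] \<in> T_tilde m"
      by (intro T_tilde_fibre) auto
    moreover have "vector [p $ 1, p $ 2, p $ 3] = p"
      by (simp add: vec3_eq_iff)
    ultimately show "p \<in> T_tilde m"
      by simp
  qed
  moreover have "vector [1/2, 1/2, real m / 4 + 1/2] \<in> ?O"
    by simp
  ultimately have "interior (T_tilde m) \<noteq> {}"
    using interior_maximal by blast
  then show ?thesis
    by (simp add: convex_body_def compact_T_tilde convex_T_tilde)
qed

lemma T_tilde_covers: "T_tilde m + integer_lattice = UNIV"
proof (intro set_eqI iffI UNIV_I)
  fix p :: "real ^ 3"
  let ?x = "frac (p $ 1)" and ?y = "frac (p $ 2)"
  let ?s = "real m * ?x * ?y"
  let ?q = "vector [?x, ?y, ?s + frac (p $ 3 - ?s)] :: real ^ 3"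
  let ?l = "vector [real_of_int \<lfloor>p $ 1\<rfloor>, real_of_int \<lfloor>p $ 2\<rfloor>, real_of_int \<lfloor>p $ 3 - ?s\<rfloor>] :: real ^ 3"
  have "?q \<in> T_tilde m"
    by (intro T_tilde_fibre) (auto simp: frac_lt_1 less_imp_le)
  moreover have "?l \<in> integer_lattice"
    by (simp add: integer_lattice_3)
  moreover have "p = ?q + ?l"
    by (simp add: vec3_eq_iff) (simp add: frac_def)
  ultimately show "p \<in> T_tilde m + integer_lattice"
    unfolding set_plus_def by blast
qed

text \<open>
  A compact interval whose integer translates cover the line has length at least 1: otherwise the
  open gap between it and its next translate is left uncovered.
\<close>

lemma compact_convex_integer_cover_contains_unit_pair:
  fixes A :: "real set"
  assumes A: "compact A" "convex A" and cover: "\<And>t. \<exists>a\<in>A. t - a \<in> \<int>"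
  obtains z where "z \<in> A" "z + 1 \<in> A"
proof -
  have "A \<noteq> {}"
    using cover by blast
  then obtain a b where ab: "A = {a..b}" "a \<le> b"
    using A connected_compact_interval_1 convex_connected by (metis atLeastatMost_empty_iff2)
  have "a + 1 \<le> b"
  proof (rule ccontr)
    assume gap: "\<not> a + 1 \<le> b"
    obtain c where c: "c \<in> A" "(b + (a + 1)) / 2 - c \<in> \<int>"
      using cover by blast
    then obtain k :: int where "(b + (a + 1)) / 2 - c = of_int k"
      by (auto elim: Ints_cases)
    then have "0 < real_of_int k" "real_of_int k < 1"
      using c ab gap by (auto simp: field_simps)
    then show False
      by simp
  qed
  then show thesis
    using ab that[of a] by auto
qed

text \<open>
  A translate of the body by a lattice vector that is not vertical misses the vertical line over an
  interior point \<open>(x, y)\<close> of the unit square, because the horizontal coordinates of the body stay in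
  \<open>[0, 1]\<close>.  So the integer translates of the fibre of \<open>K'\<close> over \<open>(x, y)\<close> have to cover that line.
\<close>

lemma covering_subbody_unit_fibre:
  assumes K': "compact K'" "convex K'" "K' \<subseteq> T_tilde m" "K' + integer_lattice = UNIV"
    and x: "0 < x" "x < 1" and y: "0 < y" "y < 1"
  obtains z where "vector [x, y, z] \<in> K'" "vector [x, y, z + 1] \<in> K'"
proof -
  let ?A = "(\<lambda>p. p $ 3) ` (K' \<inter> {p. p $ 1 = x} \<inter> {p. p $ 2 = y})"
  have mem: "vector [x, y, z] \<in> K'" if "z \<in> ?A" for z
  proof -
    from that obtain p where "p \<in> K'" "p $ 1 = x" "p $ 2 = y" "p $ 3 = z"
      by auto
    moreover from this have "p = vector [x, y, z]"
      by (simp add: vec3_eq_iff)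
    ultimately show ?thesis
      by simp
  qed
  have "compact ?A"
    by (intro compact_continuous_image compact_Int_closed K' closed_Collect_eq continuous_intros)
  moreover have "convex ?A"
  proof (rule convex_linear_image)
    show "linear (\<lambda>p :: real ^ 3. p $ 3)"
      by (simp add: linear_iff)
    have "convex {p :: real ^ 3. p $ i = a}" for i a
      by (auto simp: convex_def simp flip: distrib_right)
    then show "convex (K' \<inter> {p. p $ 1 = x} \<inter> {p. p $ 2 = y})"
      using K' by (intro convex_Int)
  qed
  moreover have "\<exists>a\<in>?A. t - a \<in> \<int>" for t
  proof -
    have "(vector [x, y, t] :: real ^ 3) \<in> K' + integer_lattice"
      using K' by simp
    then obtain k l where k: "k \<in> K'" and l: "l \<in> integer_lattice"
      and eq: "(vector [x, y, t] :: real ^ 3) = k + l"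
      unfolding set_plus_def by blast
    have eqs: "x = k $ 1 + l $ 1" "y = k $ 2 + l $ 2" "t = k $ 3 + l $ 3"
      using eq by (simp_all add: vec3_eq_iff)
    have kb: "0 \<le> k $ 1" "k $ 1 \<le> 1" "0 \<le> k $ 2" "k $ 2 \<le> 1"
      using k K' T_tilde_bounds by blast+
    have "j = 0" if "j \<in> \<int>" "-1 < j" "j < 1" for j :: real
      using that by (auto elim!: Ints_cases)
    then have "l $ 1 = 0" "l $ 2 = 0" "t - k $ 3 \<in> \<int>"
      using eqs kb l x y by (auto simp: integer_lattice_3)
    then show ?thesis
      using k eqs by (intro bexI[of _ "k $ 3"]) auto
  qed
  ultimately obtain z where "z \<in> ?A" "z + 1 \<in> ?A"
    by (rule compact_convex_integer_cover_contains_unit_pair)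
  then show thesis
    using mem that by blast
qed

text \<open>
  The points \<open>p\<close> for which \<open>p\<close> and \<open>p + e\<^sub>3\<close> both lie in \<open>K'\<close> form a compact convex set \<open>S\<close>.  Its
  projection contains the open unit square and is closed, so it contains the corners as well.
\<close>

lemma T_tilde_no_smaller_cover:
  assumes K': "compact K'" "convex K'" "K' \<subseteq> T_tilde m" "K' + integer_lattice = UNIV"
  shows "T_tilde m \<subseteq> K'"
proof -
  let ?e = "vector [0, 0, 1] :: real ^ 3"
  define S where "S = K' \<inter> (\<lambda>p. p + ?e) -` K'"
  define \<pi> :: "real ^ 3 \<Rightarrow> real \<times> real" where "\<pi> p = (p $ 1, p $ 2)" for p
  have S_mem: "p \<in> S \<longleftrightarrow> p \<in> K' \<and> p + ?e \<in> K'" for p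
    by (simp add: S_def)
  have "closed ((\<lambda>p. p + ?e) -` K')"
    by (intro closed_vimage compact_imp_closed K' continuous_intros)
  then have "compact S"
    unfolding S_def using K' by (intro compact_Int_closed)
  moreover have "continuous_on S \<pi>"
    unfolding \<pi>_def by (intro continuous_intros)
  ultimately have "closed (\<pi> ` S)"
    by (intro compact_imp_closed compact_continuous_image)
  moreover have "{0<..<1} \<times> {0<..<1} \<subseteq> \<pi> ` S"
  proof
    fix w :: "real \<times> real"
    assume w: "w \<in> {0<..<1} \<times> {0<..<1}"
    then obtain z where z: "vector [fst w, snd w, z] \<in> K'" "vector [fst w, snd w, z + 1] \<in> K'"
      using covering_subbody_unit_fibre[OF K', of "fst w" "snd w"] by (auto simp: mem_Times_iff)
    have "vector [fst w, snd w, z] + ?e = vector [fst w, snd w, z + 1]"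
      by (simp add: vec3_eq_iff)
    then have "vector [fst w, snd w, z] \<in> S"
      using z by (simp add: S_mem)
    then show "w \<in> \<pi> ` S"
      by (rule rev_image_eqI) (simp add: \<pi>_def)
  qed
  ultimately have "closure ({0<..<1} \<times> {0<..<1}) \<subseteq> \<pi> ` S"
    by (rule closure_minimal[rotated])
  then have square: "{0..1} \<times> {0..1} \<subseteq> \<pi> ` S"
    by (simp add: closure_Times)
  \<comment> \<open>The body has no room beyond length 1 over a corner, which fixes the unit segment there.\<close>
  have corner: "vector [x, y, real m * x * y] \<in> S" if "x = 0 \<or> x = 1" "y = 0 \<or> y = 1" for x y
  proof -
    have "(x, y) \<in> \<pi> ` S"
      using square that by auto
    then obtain p where p: "p \<in> S" and xy: "p $ 1 = x" "p $ 2 = y"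
      by (auto simp: \<pi>_def)
    have "p \<in> T_tilde m" "p + ?e \<in> T_tilde m"
      using p K' by (auto simp: S_mem)
    then have "p $ 3 = real m * x * y"
      using that xy T_tilde_bounds(5,6)[of p m] T_tilde_bounds(7,8)[of "p + ?e" m] by auto
    then have "p = vector [x, y, real m * x * y]"
      using xy by (simp add: vec3_eq_iff)
    with p show ?thesis
      by simp
  qed
  have "convex S"
  proof -
    have "(\<lambda>p. p + ?e) -` K' = (\<lambda>p. - ?e + p) ` K'"
      by (auto simp: image_iff algebra_simps intro!: bexI)
    then have "convex ((\<lambda>p. p + ?e) -` K')"
      using K' by (simp add: convex_translation)
    then show ?thesis
      unfolding S_def using K' by (intro convex_Int)
  qed
  then have "T m \<subseteq> S"
    unfolding T_def
    using corner[of 0 0] corner[of 1 0] corner[of 0 1] corner[of 1 1] by (intro hull_minimal) auto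
  show ?thesis
  proof
    fix p
    assume "p \<in> T_tilde m"
    then obtain q t where q: "q \<in> T m" and t: "0 \<le> t" "t \<le> 1" and p: "p = q + vector [0, 0, t]"
      unfolding T_tilde_iff by blast
    have "(1 - t) *\<^sub>R q + t *\<^sub>R (q + ?e) \<in> K'"
      using q \<open>T m \<subseteq> S\<close> t by (intro convexD K') (auto simp: S_mem)
    also have "(1 - t) *\<^sub>R q + t *\<^sub>R (q + ?e) = p"
      by (simp add: p vec3_eq_iff algebra_simps)
    finally show "p \<in> K'" .
  qed
qed

lemma minimal_covering_pair_T_tilde: "minimal_covering_pair (T_tilde m) integer_lattice"
  unfolding minimal_covering_pair_def minimal_covering_body_def
proof (intro conjI allI impI notI full_rank_integer_lattice convex_body_T_tilde T_tilde_covers)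
  fix K'
  assume "convex_body K' \<and> K' \<subset> T_tilde m" "K' + integer_lattice = UNIV"
  then show False
    using T_tilde_no_smaller_cover[of K' m] by (auto simp: convex_body_def)
qed

lemma not_centrally_symmetric_T_tilde:
  assumes "m \<ge> 1"
  shows "\<not> centrally_symmetric (T_tilde m)"
proof
  assume "centrally_symmetric (T_tilde m)"
  then obtain c where c: "(\<lambda>x. 2 *\<^sub>R c - x) ` T_tilde m = T_tilde m"
    unfolding centrally_symmetric_def by blast
  then have refl: "2 *\<^sub>R c - p \<in> T_tilde m" if "p \<in> T_tilde m" for p
    using that by blast
  note V = T_tilde_vertices[of m]
  have "2 * c $ 1 = 1" "2 * c $ 2 = 1"
    using T_tilde_bounds(2,4)[OF refl[OF V(1)]] T_tilde_bounds(1,3)[OF refl[OF V(5)]] by auto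
  moreover from this have "real m + 1 \<le> 2 * c $ 3"
    using T_tilde_bounds(6)[OF refl[OF V(2)]] by simp
  moreover have "2 * c $ 3 \<le> 1"
    using T_tilde_bounds(7)[OF refl[OF V(3)]] \<open>2 * c $ 1 = 1\<close> by simp
  ultimately show False
    using assms by simp
qed


section \<open>Distinguishing the contact types\<close>

text \<open>
  A vertical difference of two points of \<open>T_tilde n\<close> has length at most \<open>n/2 + 1\<close>; the midpoints of
  \<open>p, q\<close> and of \<open>r, s\<close> are such a pair of points.  The bound \<open>n/2\<close> arises as the smaller of
  \<open>n y\<close> and \<open>n (1 - y)\<close>, maximised over \<open>y\<close>.
\<close>

lemma vertical_double_difference_le:
  assumes "p \<in> T_tilde n" "q \<in> T_tilde n" "r \<in> T_tilde n" "s \<in> T_tilde n"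
    and x: "p $ 1 + q $ 1 = r $ 1 + s $ 1" and y: "p $ 2 + q $ 2 = r $ 2 + s $ 2"
  shows "p $ 3 + q $ 3 - r $ 3 - s $ 3 \<le> real n + 2"
proof -
  note b = T_tilde_bounds[OF assms(1)] T_tilde_bounds[OF assms(2)]
    T_tilde_bounds[OF assms(3)] T_tilde_bounds[OF assms(4)]
  let ?D = "p $ 3 + q $ 3 - r $ 3 - s $ 3"
  have "?D \<le> real n * (r $ 2 + s $ 2) + 2"
    using b by (simp flip: y add: distrib_left)
  moreover have "?D \<le> real n * (2 - (r $ 2 + s $ 2)) + 2"
  proof -
    have "p $ 3 + q $ 3 \<le> real n * (r $ 1 + s $ 1) + 2"
      using b by (simp flip: x add: distrib_left)
    moreover have "real n * (r $ 1 + s $ 1 + (r $ 2 + s $ 2) - 2) \<le> r $ 3 + s $ 3"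
      using b by (simp add: algebra_simps)
    ultimately show ?thesis
      by (simp add: algebra_simps)
  qed
  ultimately show ?thesis
    by (simp add: algebra_simps)
qed

text \<open>
  A horizontal coordinate of \<open>k w = p + q - r - s\<close> is at most 2 in absolute value, so for \<open>k > 2\<close> the
  integer vector \<open>w\<close> must be vertical.
\<close>

lemma multiple_in_double_difference_le:
  assumes pqrs: "p \<in> T_tilde n" "q \<in> T_tilde n" "r \<in> T_tilde n" "s \<in> T_tilde n"
    and w: "w \<in> integer_lattice" "w \<noteq> 0"
    and eq: "p + q = r + s + real k *\<^sub>R w"
  shows "k \<le> n + 2"
proof (cases "k \<le> 2")
  case False
  note b = T_tilde_bounds(1-4)[OF pqrs(1)] T_tilde_bounds(1-4)[OF pqrs(2)]
    T_tilde_bounds(1-4)[OF pqrs(3)] T_tilde_bounds(1-4)[OF pqrs(4)]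
  have eqs: "p $ i + q $ i = r $ i + s $ i + real k * w $ i" for i
    using arg_cong[OF eq, of "\<lambda>v. v $ i"] by simp
  have k_le: "real k \<le> \<bar>real k * j\<bar>" if "j \<in> \<int>" "j \<noteq> 0" for j :: real
    using Ints_nonzero_abs_ge1[OF that] by (simp add: abs_mult mult_le_cancel_left1)
  have "\<bar>real k * w $ 1\<bar> < real k" "\<bar>real k * w $ 2\<bar> < real k"
    using b eqs[of 1] eqs[of 2] False by linarith+
  then have w12: "w $ 1 = 0" "w $ 2 = 0"
    using k_le w by (force simp: integer_lattice_3)+
  then have "w $ 3 \<noteq> 0"
    using w by (simp add: vec3_eq_iff)
  then have "real k \<le> \<bar>real k * w $ 3\<bar>"
    using k_le w by (simp add: integer_lattice_3)
  also have "\<dots> \<le> real n + 2"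
    using eqs[of 1] eqs[of 2] eqs[of 3] w12
      vertical_double_difference_le[OF pqrs] vertical_double_difference_le[OF pqrs(3,4,1,2)]
    by simp
  finally show ?thesis
    by linarith
qed simp

text \<open>
  The relation \<open>e\<^sub>3 + (1, 1, m + 1) = (1, 0, 0) + (0, 1, 0) + (m + 2) e\<^sub>3\<close> between points of the contact
  set of \<open>0\<close> is transported by \<open>U\<close> into the second body, where the bound on multiples applies.
\<close>

lemma contact_set_isomorphism_imp_le:
  assumes U: "lattice_isomorphism integer_lattice integer_lattice U"
    and contact: "U ` contact_set (T_tilde m) integer_lattice 0 \<subseteq>
      contact_set (T_tilde n) integer_lattice v"
  shows "m \<le> n"
proof -
  let ?e = "vector [0, 0, 1] :: real ^ 3" and ?b = "vector [1, 0, 0] :: real ^ 3"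
    and ?c = "vector [0, 1, 0] :: real ^ 3" and ?d = "vector [1, 1, real m + 1] :: real ^ 3"
  have L: "?e \<in> integer_lattice" "?b \<in> integer_lattice" "?c \<in> integer_lattice"
    "?d \<in> integer_lattice"
    by (simp_all add: integer_lattice_3)
  have mem: "v + U z \<in> T_tilde n" if "z \<in> integer_lattice" "z \<in> T_tilde m" for z
    using contact that by (auto simp: contact_set_def)
  have "?e + ?d = ?b + ?c + real (m + 2) *\<^sub>R ?e"
    by (simp add: vec3_eq_iff)
  then have "U (?e + ?d) = U (?b + ?c + real (m + 2) *\<^sub>R ?e)"
    by (rule arg_cong)
  then have "U ?e + U ?d = U ?b + U ?c + real (m + 2) *\<^sub>R U ?e"
    using L by (simp only: lattice_isomorphism_add[OF U] lattice_isomorphism_scale_nat[OF U]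
        integer_lattice_add integer_lattice_scale_nat)
  then have eq: "(v + U ?e) + (v + U ?d) = (v + U ?b) + (v + U ?c) + real (m + 2) *\<^sub>R U ?e"
    by (simp add: algebra_simps)
  have "U ?e \<in> integer_lattice"
    using U L by (auto simp: lattice_isomorphism_def bij_betw_def)
  moreover have "U ?e \<noteq> 0"
    using L by (intro lattice_isomorphism_nonzero[OF U]) (simp_all add: vec3_eq_iff)
  ultimately have "m + 2 \<le> n + 2"
    using multiple_in_double_difference_le[OF mem mem mem mem _ _ eq] L T_tilde_vertices by blast
  then show ?thesis
    by simp
qed

lemma same_arithmetic_contact_type_T_tilde_imp_eq:
  assumes "same_arithmetic_contact_type (T_tilde m) (integer_lattice :: (real ^ 3) set)
    (T_tilde n) (integer_lattice :: (real ^ 3) set)"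
  shows "m = n"
proof (rule antisym)
  from assms obtain U \<phi> \<Phi>
    where iso: "profile_isomorphism (T_tilde m) integer_lattice (T_tilde n) integer_lattice U \<phi> \<Phi>"
    unfolding same_arithmetic_contact_type_def by blast
  then have U: "lattice_isomorphism integer_lattice integer_lattice U"
    and \<phi>: "bij_betw \<phi> (vertices (T_tilde m)) (vertices (T_tilde n))"
    and contact: "\<And>v. v \<in> vertices (T_tilde m) \<Longrightarrow>
      U ` contact_set (T_tilde m) integer_lattice v = contact_set (T_tilde n) integer_lattice (\<phi> v)"
    by (simp_all add: profile_isomorphism_def)
  show "m \<le> n"
    using contact_set_isomorphism_imp_le[OF U] contact[OF zero_in_vertices_T_tilde] by blast
  \<comment> \<open>Conversely, pull the vertex \<open>0\<close> of the second body back to the first and invert \<open>U\<close>.\<close>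
  obtain v where v: "v \<in> vertices (T_tilde m)" "\<phi> v = 0"
    using \<phi> zero_in_vertices_T_tilde by (metis bij_betw_imp_surj_on imageE)
  have "inj_on U integer_lattice"
    using U by (simp add: lattice_isomorphism_def bij_betw_def)
  moreover have "contact_set (T_tilde m) integer_lattice v \<subseteq> integer_lattice"
    by (auto simp: contact_set_def)
  ultimately have "inv_into integer_lattice U ` contact_set (T_tilde n) integer_lattice 0 =
      contact_set (T_tilde m) integer_lattice v"
    using contact[OF v(1)] v(2) by (metis inv_into_image_cancel)
  then show "n \<le> m"
    using contact_set_isomorphism_imp_le[OF lattice_isomorphism_inv_into[OF U integer_lattice_add]]
    by blast
qed

theorem theorem1p2:
  shows "(\<forall>m::nat. m \<ge> 1 \<longrightarrow>
            minimal_covering_pair (T_tilde m) (integer_lattice :: (real ^ 3) set) \<and>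
            \<not> centrally_symmetric (T_tilde m)) \<and>
         (\<forall>m n::nat. m \<ge> 1 \<longrightarrow> n \<ge> 1 \<longrightarrow> m \<noteq> n \<longrightarrow>
            \<not> same_arithmetic_contact_type (T_tilde m) (integer_lattice :: (real ^ 3) set)
                                          (T_tilde n) (integer_lattice :: (real ^ 3) set))"
  using minimal_covering_pair_T_tilde not_centrally_symmetric_T_tilde
    same_arithmetic_contact_type_T_tilde_imp_eq by blast

end
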